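(* Let $1\le i\le k$ and let $\alpha_{i,n}$ be an arbitrary positive real number. The cdf $H_{S,n,\theta,\sigma}^i$ of $\sigma^{-1}\alpha_{i,n}(\hat\theta_{S,i}-\theta_i)$ under $P_{n,\theta,\sigma}$ is given by $$H_{S,n,\theta,\sigma}^i(x)=\Phi\left(n^{1/2}x/(\alpha_{i,n}\xi_{i,n})+n^{1/2}\eta_{i,n}\right)\mathbf{1}\left(\alpha_{i,n}^{-1}x+\theta_i/\sigma\ge0\right)+\Phi\left(n^{1/2}x/(\alpha_{i,n}\xi_{i,n})-n^{1/2}\eta_{i,n}\right)\mathbf{1}\left(\alpha_{i,n}^{-1}x+\theta_i/\sigma<0\right),$$ or, equivalently, the corresponding measure is $$dH_{S,n,\theta,\sigma}^i(x)=\left\{\Phi\left(n^{1/2}(-\theta_i/(\sigma\xi_{i,n})+\eta_{i,n})\right)-\Phi\left(n^{1/2}(-\theta_i/(\sigma\xi_{i,n})-\eta_{i,n})\right)\right\}d\delta_{-\alpha_{i,n}\theta_i/\sigma}(x)$$ $$+\left(n^{1/2}/(\alpha_{i,n}\xi_{i,n})\right)\Big\{\phi\left(n^{1/2}x/(\alpha_{i,n}\xi_{i,n})+n^{1/2}\eta_{i,n}\right)\mathbf{1}\left(\alpha_{i,n}^{-1}x+\theta_i/\sigma>0\right)$$ $$\qquad+\,\phi\left(n^{1/2}x/(\alpha_{i,n}\xi_{i,n})-n^{1/2}\eta_{i,n}\right)\mathbf{1}\left(\alpha_{i,n}^{-1}x+\theta_i/\sigma<0\right)\Big\}dx,$$ where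 $\delta_z$ denotes pointmass at $z$.
   Context: Consider the linear regression model $Y=X\theta+u$, where $X$ is a nonstochastic $n\times k$ matrix of rank $k\ge1$ ($n\ge k$), $\theta\in\mathbb{R}^k$, $u\sim N(0,\sigma^2I_n)$, $0<\sigma<\infty$; $P_{n,\theta,\sigma}$ denotes probability under parameters $\theta,\sigma$. $X'$ is the transpose of $X$. $\xi_{i,n}$ is the nonnegative square root of the $i$-th diagonal element of $(X'X/n)^{-1}$. $\hat\theta_{LS}=(X'X)^{-1}X'Y$ with $i$-th component $\hat\theta_{LS,i}$. The tuning parameter $\eta_{i,n}$ is a positive real number. The infeasible (known-variance) soft-thresholding estimator is $\hat\theta_{S,i}=\mathrm{sign}(\hat\theta_{LS,i})(|\hat\theta_{LS,i}|-\sigma\xi_{i,n}\eta_{i,n})_+$ with $(\cdot)_+=\max(\cdot,0)$. $\Phi,\phi$ are the standard normal cdf and pdf. *)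

theory Defs
  imports "HOL-Probability.Probability"
begin

text \<open>Lebesgue density of \<open>N(\<mu>, \<Sigma>)\<close>. It is the right notion for positive definite \<open>\<Sigma>\<close> only;
  \<^const>\<open>matrix_inv\<close> is unspecified for singular matrices.\<close>
definition mv_normal_density :: "real^'n \<Rightarrow> real^'n^'n \<Rightarrow> real^'n \<Rightarrow> real" where
  "mv_normal_density \<mu> \<Sigma> z =
     1 / sqrt ((2 * pi) ^ CARD('n) * det \<Sigma>) *
     exp (- ((z - \<mu>) \<bullet> (matrix_inv \<Sigma> *v (z - \<mu>))) / 2)"

definition std_normal_cdf :: "real \<Rightarrow> real" where
  "std_normal_cdf = cdf std_normal_distribution"

text \<open>A design matrix \<open>X :: real^'k^'n\<close> has \<open>n = CARD('n)\<close> rows (observations) and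
  \<open>k = CARD('k)\<close> columns (regressors). The inverses below are genuine inverses
  when \<open>X\<close> has rank \<open>k\<close>.\<close>

definition ls_estimator :: "real^'k^'n \<Rightarrow> real^'n \<Rightarrow> real^'k" where
  "ls_estimator X y = matrix_inv (transpose X ** X) *v (transpose X *v y)"

definition xi :: "real^'k^'n \<Rightarrow> 'k \<Rightarrow> real" where
  "xi X i = sqrt (matrix_inv ((1 / real CARD('n)) *\<^sub>R (transpose X ** X)) $ i $ i)"

definition soft_threshold_estimator ::
    "real^'k^'n \<Rightarrow> real \<Rightarrow> real \<Rightarrow> real^'n \<Rightarrow> 'k \<Rightarrow> real" where
  "soft_threshold_estimator X \<sigma> \<eta> y i =
     sgn (ls_estimator X y $ i) * max (\<bar>ls_estimator X y $ i\<bar> - \<sigma> * xi X i * \<eta>) 0"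

end

theory Submission
  imports Defs
begin

text \<open>The least squares estimator is linear in \<open>Y\<close>, so its \<open>i\<close>-th component is \<open>\<theta> $ i + a \<bullet> u\<close>
  for a fixed vector \<open>a \<noteq> 0\<close>, and \<open>norm a = \<xi> / sqrt n\<close> because the squared length of row \<open>i\<close> of
  \<open>(X'X)\<^sup>-\<^sup>1 X'\<close> is the \<open>i\<close>-th diagonal entry of \<open>(X'X)\<^sup>-\<^sup>1\<close>
  (\<open>ls_estimator_component_error\<close>). An isotropic Gaussian vector has independent normal coordinates,
  so every linear functional of it is normal (\<open>distributed_inner_isotropic_normal\<close>); thus
  \<open>a \<bullet> u = s * Z\<close> with \<open>Z\<close> standard normal and \<open>s = \<sigma> * \<xi> / sqrt n\<close>.

  Soft thresholding is positively homogeneous jointly in threshold and argument, hence measuring everything in units of \<open>s\<close> turns the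
  scaled estimation error into \<open>c * (soft_threshold e (Z + \<mu>) - \<mu>)\<close> with \<open>c = \<alpha> * \<xi> / sqrt n\<close>,
  \<open>\<mu> = \<theta> $ i / s\<close> and \<open>e = sqrt n * \<eta>\<close>, and what remains is the law of a function of one standard
  normal variable. For the distribution function, soft thresholding is monotone with the explicit
  generalised inverse \<open>y \<mapsto> y + e\<close> for \<open>y \<ge> 0\<close> and \<open>y \<mapsto> y - e\<close> for \<open>y < 0\<close>
  (\<open>cdf_soft_threshold_std_normal\<close>). For the measure, split the line according to the position of
  \<open>Z + \<mu>\<close> relative to \<open>{-e..e}\<close>: the middle part is mapped to one point and gives the atom, and on
  each outer part the map is affine and gives a shifted normal density
  (\<open>emeasure_soft_threshold_std_normal\<close>).\<close>

section \<open>Linear functionals of an isotropic Gaussian vector\<close>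

text \<open>Lebesgue measure on a Euclidean space is the product of the one-dimensional Lebesgue measures along
  \<open>Basis\<close>, so a density that factorises over the coordinates gives rectangles a product probability.
  Both the marginals and the independence of the coordinates are read off from this.\<close>
lemma (in prob_space) emeasure_rectangle_product_density:
  fixes u :: "'a \<Rightarrow> 'b::euclidean_space" and f :: "'b \<Rightarrow> real \<Rightarrow> real"
  assumes u: "distributed M lborel u (\<lambda>z. ennreal (\<Prod>b\<in>Basis. f b (z \<bullet> b)))"
    and f [measurable]: "\<And>b. f b \<in> borel_measurable borel"
    and nonneg: "\<And>b x. 0 \<le> f b x"
    and A [measurable]: "\<And>b. b \<in> Basis \<Longrightarrow> A b \<in> sets borel"
  shows "emeasure M {\<omega> \<in> space M. \<forall>b\<in>Basis. u \<omega> \<bullet> b \<in> A b} =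
    (\<Prod>b\<in>Basis. emeasure (density lborel (f b)) (A b))"
proof -
  have um [measurable]: "u \<in> borel_measurable M"
    using distributed_measurable[OF u] by simp
  let ?R = "{z::'b. \<forall>b\<in>Basis. z \<bullet> b \<in> A b}"
  have R [measurable]: "?R \<in> sets borel" by measurable
  have "emeasure M {\<omega> \<in> space M. \<forall>b\<in>Basis. u \<omega> \<bullet> b \<in> A b} = emeasure (distr M lborel u) ?R"
    by (subst emeasure_distr) (auto intro!: arg_cong[where f="emeasure M"])
  also have "\<dots> = (\<integral>\<^sup>+z. ennreal (\<Prod>b\<in>Basis. f b (z \<bullet> b)) * indicator ?R z \<partial>lborel)"
    unfolding distributed_distr_eq_density[OF u]
    using distributed_borel_measurable[OF u] R by (subst emeasure_density) simp_all
  also have "\<dots> = (\<integral>\<^sup>+z. (\<Prod>b\<in>Basis. ennreal (f b (z \<bullet> b)) * indicator (A b) (z \<bullet> b)) \<partial>lborel)"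
  proof (intro nn_integral_cong)
    fix z :: 'b
    have "indicator ?R z = (\<Prod>b\<in>Basis. indicator (A b) (z \<bullet> b) :: ennreal)"
    proof (cases "z \<in> ?R")
      case False
      then obtain b where b: "b \<in> Basis" "z \<bullet> b \<notin> A b" by auto
      then have "(\<Prod>b\<in>Basis. indicator (A b) (z \<bullet> b) :: ennreal) = 0"
        by (intro prod_zero bexI[of _ b]) auto
      with False show ?thesis by simp
    qed simp
    then show "ennreal (\<Prod>b\<in>Basis. f b (z \<bullet> b)) * indicator ?R z =
        (\<Prod>b\<in>Basis. ennreal (f b (z \<bullet> b)) * indicator (A b) (z \<bullet> b))"
      by (simp add: prod.distrib prod_ennreal nonneg)
  qed
  also have "\<dots> = (\<Prod>b\<in>Basis. \<integral>\<^sup>+x. ennreal (f b x) * indicator (A b) x \<partial>lborel)"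
    by (rule nn_integral_lborel_prod) simp_all
  also have "\<dots> = (\<Prod>b\<in>Basis. emeasure (density lborel (f b)) (A b))"
    by (intro prod.cong refl) (simp add: emeasure_density)
  finally show ?thesis .
qed

text \<open>The case of a rectangle with only one side restricted; the remaining factors are probabilities of
  the whole line.\<close>
lemma (in prob_space) distributed_inner_Basis_product_density:
  fixes u :: "'a \<Rightarrow> 'b::euclidean_space" and f :: "'b \<Rightarrow> real \<Rightarrow> real"
  assumes u: "distributed M lborel u (\<lambda>z. ennreal (\<Prod>b\<in>Basis. f b (z \<bullet> b)))"
    and f [measurable]: "\<And>b. f b \<in> borel_measurable borel"
    and nonneg: "\<And>b x. 0 \<le> f b x"
    and prob: "\<And>b. prob_space (density lborel (f b))"
    and c: "c \<in> Basis"
  shows "distributed M lborel (\<lambda>\<omega>. u \<omega> \<bullet> c) (f c)"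
proof -
  have um [measurable]: "u \<in> borel_measurable M"
    using distributed_measurable[OF u] by simp
  have "distr M lborel (\<lambda>\<omega>. u \<omega> \<bullet> c) = density lborel (f c)"
  proof (rule measure_eqI)
    fix B assume "B \<in> sets (distr M lborel (\<lambda>\<omega>. u \<omega> \<bullet> c))"
    then have B [measurable]: "B \<in> sets borel" by simp
    let ?A = "\<lambda>b. if b = c then B else UNIV"
    have "emeasure (distr M lborel (\<lambda>\<omega>. u \<omega> \<bullet> c)) B =
        emeasure M {\<omega> \<in> space M. \<forall>b\<in>Basis. u \<omega> \<bullet> b \<in> ?A b}"
      using c by (subst emeasure_distr) (auto intro!: arg_cong[where f="emeasure M"])
    also have "\<dots> = (\<Prod>b\<in>Basis. emeasure (density lborel (f b)) (?A b))"
      by (rule emeasure_rectangle_product_density[OF u f nonneg]) auto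
    also have "\<dots> = (\<Prod>b\<in>Basis. if b = c then emeasure (density lborel (f c)) B else 1)"
      using prob_space.emeasure_space_1[OF prob] by (intro prod.cong) auto
    also have "\<dots> = emeasure (density lborel (f c)) B"
      using c by simp
    finally show "emeasure (distr M lborel (\<lambda>\<omega>. u \<omega> \<bullet> c)) B = emeasure (density lborel (f c)) B" .
  qed simp
  then show ?thesis
    by (simp add: distributed_def)
qed

lemma (in prob_space) indep_vars_inner_Basis_product_density:
  fixes u :: "'a \<Rightarrow> 'b::euclidean_space" and f :: "'b \<Rightarrow> real \<Rightarrow> real"
  assumes u: "distributed M lborel u (\<lambda>z. ennreal (\<Prod>b\<in>Basis. f b (z \<bullet> b)))"
    and f [measurable]: "\<And>b. f b \<in> borel_measurable borel"
    and nonneg: "\<And>b x. 0 \<le> f b x"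
    and prob: "\<And>b. prob_space (density lborel (f b))"
  shows "indep_vars (\<lambda>_. borel) (\<lambda>b \<omega>. u \<omega> \<bullet> b) Basis"
proof -
  have um [measurable]: "u \<in> borel_measurable M"
    using distributed_measurable[OF u] by simp
  let ?N = "\<lambda>b. distr M borel (\<lambda>\<omega>. u \<omega> \<bullet> b)"
  interpret N: product_prob_space ?N Basis
    by (intro product_prob_spaceI prob_space_distr) measurable
  have N: "?N b = density lborel (f b)" if "b \<in> Basis" for b
    using distributed_distr_eq_density[OF distributed_inner_Basis_product_density[OF u f nonneg prob that]]
    by (metis distr_cong sets_lborel)
  have "distr M (\<Pi>\<^sub>M b\<in>Basis. borel) (\<lambda>\<omega>. \<lambda>b\<in>Basis. u \<omega> \<bullet> b) = (\<Pi>\<^sub>M b\<in>Basis. ?N b)"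
  proof (rule N.PiM_eqI)
    show "sets (distr M (\<Pi>\<^sub>M b\<in>Basis. borel) (\<lambda>\<omega>. \<lambda>b\<in>Basis. u \<omega> \<bullet> b)) = sets (\<Pi>\<^sub>M b\<in>Basis. ?N b)"
      by (simp, intro sets_PiM_cong) simp_all
    fix A :: "'b \<Rightarrow> real set"
    assume "\<And>b. b \<in> Basis \<Longrightarrow> A b \<in> sets (?N b)"
    then have A [measurable]: "\<And>b. b \<in> Basis \<Longrightarrow> A b \<in> sets borel" by simp
    have "emeasure (distr M (\<Pi>\<^sub>M b\<in>Basis. borel) (\<lambda>\<omega>. \<lambda>b\<in>Basis. u \<omega> \<bullet> b)) (Pi\<^sub>E Basis A)
        = emeasure M {\<omega> \<in> space M. \<forall>b\<in>Basis. u \<omega> \<bullet> b \<in> A b}"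
      by (subst emeasure_distr)
        (auto intro!: arg_cong[where f="emeasure M"] sets_PiM_I_finite measurable_restrict)
    also have "\<dots> = (\<Prod>b\<in>Basis. emeasure (density lborel (f b)) (A b))"
      by (rule emeasure_rectangle_product_density[OF u f nonneg A])
    finally show "emeasure (distr M (\<Pi>\<^sub>M b\<in>Basis. borel) (\<lambda>\<omega>. \<lambda>b\<in>Basis. u \<omega> \<bullet> b)) (Pi\<^sub>E Basis A)
        = (\<Prod>b\<in>Basis. emeasure (?N b) (A b))"
      by (simp add: N)
  qed simp
  then show ?thesis
    by (subst indep_vars_iff_distr_eq_PiM) auto
qed

text \<open>\<open>a \<bullet> u\<close> is the sum of the independent normal variables \<open>(a \<bullet> b) * (u \<bullet> b)\<close> for \<open>b\<close> in \<open>Basis\<close>,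
  whose variances \<open>(\<sigma> * (a \<bullet> b))\<^sup>2\<close> add up to \<open>(\<sigma> * norm a)\<^sup>2\<close>.\<close>
lemma (in prob_space) distributed_inner_isotropic_normal:
  fixes u :: "'a \<Rightarrow> 'b::euclidean_space" and a :: 'b
  assumes u: "distributed M lborel u (\<lambda>z. ennreal (\<Prod>b\<in>Basis. normal_density 0 \<sigma> (z \<bullet> b)))"
    and \<sigma>: "0 < \<sigma>" and a: "a \<noteq> 0"
  shows "distributed M lborel (\<lambda>\<omega>. a \<bullet> u \<omega>) (normal_density 0 (\<sigma> * norm a))"
proof -
  \<comment> \<open>Coordinates with coefficient 0 contribute a constant, which has no normal density, so they are left out.\<close>
  let ?J = "{b \<in> Basis. a \<bullet> b \<noteq> 0}"
  \<comment> \<open>The summand 0 gives the shape of an affine transformation of a normal variable.\<close>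
  let ?X = "\<lambda>b \<omega>. 0 + (a \<bullet> b) * (u \<omega> \<bullet> b)"
  note prob = prob_space_normal_density[OF \<sigma>, of 0]
  have "indep_vars (\<lambda>_. borel) (\<lambda>b \<omega>. u \<omega> \<bullet> b) Basis"
    by (rule indep_vars_inner_Basis_product_density[where f="\<lambda>_. normal_density 0 \<sigma>", OF u]) (simp_all add: prob)
  then have indep: "indep_vars (\<lambda>_. borel) ?X ?J"
    by (rule indep_vars_compose2[OF indep_vars_subset[where J="?J"]]) auto
  have normal: "distributed M lborel (?X b) (normal_density 0 (\<sigma> * \<bar>a \<bullet> b\<bar>))" if "b \<in> ?J" for b
  proof -
    have "distributed M lborel (\<lambda>\<omega>. u \<omega> \<bullet> b) (normal_density 0 \<sigma>)"
      using that by (intro distributed_inner_Basis_product_density[where f="\<lambda>_. normal_density 0 \<sigma>", OF u]) (simp_all add: prob)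
    from normal_density_affine[OF this \<sigma>, of "a \<bullet> b" 0] that
    show ?thesis by (simp add: mult.commute)
  qed
  have "?J \<noteq> {}"
    using a euclidean_all_zero_iff[of a] by auto
  then have "distributed M lborel (\<lambda>\<omega>. \<Sum>b\<in>?J. ?X b \<omega>)
      (normal_density (\<Sum>b\<in>?J. 0) (sqrt (\<Sum>b\<in>?J. (\<sigma> * \<bar>a \<bullet> b\<bar>)\<^sup>2)))"
    using \<sigma> by (intro sum_indep_normal[OF _ _ indep _ normal]) auto
  moreover have "(\<Sum>b\<in>?J. ?X b \<omega>) = a \<bullet> u \<omega>" for \<omega>
    unfolding euclidean_inner[of a "u \<omega>"] by (intro sum.mono_neutral_cong_left) auto
  moreover have "sqrt (\<Sum>b\<in>?J. (\<sigma> * \<bar>a \<bullet> b\<bar>)\<^sup>2) = \<sigma> * norm a"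
  proof -
    have "(\<Sum>b\<in>?J. (\<sigma> * \<bar>a \<bullet> b\<bar>)\<^sup>2) = (\<Sum>b\<in>Basis. (\<sigma> * \<bar>a \<bullet> b\<bar>)\<^sup>2)"
      by (intro sum.mono_neutral_cong_left) auto
    also have "\<dots> = (\<sigma> * norm a)\<^sup>2"
    proof -
      have "(norm a)\<^sup>2 = (\<Sum>b\<in>Basis. (a \<bullet> b)\<^sup>2)"
        unfolding power2_norm_eq_inner by (subst euclidean_inner) (simp add: power2_eq_square)
      then show ?thesis
        by (simp add: power_mult_distrib sum_distrib_left)
    qed
    finally show ?thesis using \<sigma> by (simp add: real_sqrt_abs abs_mult)
  qed
  ultimately show ?thesis by simp
qed

lemma matrix_inv_eqI:
  fixes A :: "real^'n^'n"
  assumes "A ** B = mat 1"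
  shows "matrix_inv A = B"
proof -
  have "B ** A = mat 1" using assms matrix_left_right_inverse by blast
  with assms have "A ** matrix_inv A = mat 1 \<and> matrix_inv A ** A = mat 1"
    unfolding matrix_inv_def by (intro someI_ex[where P="\<lambda>A'. A ** A' = mat 1 \<and> A' ** A = mat 1"]) blast
  then show ?thesis
    using \<open>B ** A = mat 1\<close> by (metis matrix_mul_assoc matrix_mul_lid matrix_mul_rid)
qed

text \<open>The covariance matrix is diagonal, so the quadratic form in the exponent is the sum of the squared
  coordinates over \<open>\<sigma>\<^sup>2\<close>, and its determinant supplies one factor \<open>\<sigma>\<^sup>2\<close> for each coordinate.\<close>
lemma mv_normal_density_isotropic:
  fixes z :: "real^'n"
  assumes \<sigma>: "0 < \<sigma>"
  shows "mv_normal_density 0 (\<sigma>\<^sup>2 *\<^sub>R mat 1) z = (\<Prod>b\<in>Basis. normal_density 0 \<sigma> (z \<bullet> b))"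
proof -
  have inv: "matrix_inv (\<sigma>\<^sup>2 *\<^sub>R mat 1 :: real^'n^'n) = (1 / \<sigma>\<^sup>2) *\<^sub>R mat 1"
    using \<sigma> by (intro matrix_inv_eqI)
      (simp add: matrix_scalar_ac scalar_matrix_assoc[symmetric])
  have det: "det (\<sigma>\<^sup>2 *\<^sub>R mat 1 :: real^'n^'n) = (\<sigma>\<^sup>2) ^ CARD('n)"
    by (subst det_diagonal) (simp_all add: mat_def)
  have quad: "z \<bullet> (((1 / \<sigma>\<^sup>2) *\<^sub>R mat 1) *v z) = (\<Sum>b\<in>Basis. (z \<bullet> b)\<^sup>2) / \<sigma>\<^sup>2"
    by (simp add: scaleR_matrix_vector_assoc[symmetric] euclidean_inner[of z z] power2_eq_square)
  have "(\<Prod>b\<in>Basis. normal_density 0 \<sigma> (z \<bullet> b)) =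
      (\<Prod>b\<in>(Basis::(real^'n) set). 1 / sqrt (2 * pi * \<sigma>\<^sup>2)) * exp (\<Sum>b\<in>Basis. - (z \<bullet> b)\<^sup>2 / (2 * \<sigma>\<^sup>2))"
    by (simp add: normal_density_def prod.distrib prod_dividef exp_sum power_one_over)
  also have "(\<Prod>b\<in>(Basis::(real^'n) set). 1 / sqrt (2 * pi * \<sigma>\<^sup>2)) = 1 / sqrt ((2 * pi) ^ CARD('n) * (\<sigma>\<^sup>2) ^ CARD('n))"
    by (simp add: power_one_over power_mult_distrib real_sqrt_power real_sqrt_mult)
  also have "(\<Sum>b\<in>Basis. - (z \<bullet> b)\<^sup>2 / (2 * \<sigma>\<^sup>2)) = - ((\<Sum>b\<in>Basis. (z \<bullet> b)\<^sup>2) / \<sigma>\<^sup>2) / 2"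
    by (simp add: sum_divide_distrib sum_negf mult.commute)
  finally show ?thesis
    unfolding mv_normal_density_def by (simp add: inv det quad)
qed

section \<open>The least squares estimator\<close>

text \<open>\<open>X'X x = 0\<close> forces \<open>(X x) \<bullet> (X x) = x \<bullet> (X'X x) = 0\<close>, so \<open>X'X\<close> inherits injectivity from \<open>X\<close>.\<close>
lemma gram_matrix_inverse:
  fixes X :: "real^'k^'n"
  assumes "rank X = CARD('k)"
  shows "matrix_inv (transpose X ** X) ** (transpose X ** X) = mat 1"
proof -
  have "x = 0" if "(transpose X ** X) *v x = 0" for x
  proof -
    have "(X *v x) \<bullet> (X *v x) = x \<bullet> ((transpose X ** X) *v x)"
      by (metis dot_lmul_matrix matrix_vector_mul_assoc vector_transpose_matrix inner_commute)
    with that have "X *v x = 0" by simp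
    moreover have "inj ((*v) X)" using assms full_rank_injective by blast
    ultimately show ?thesis by (metis injD matrix_vector_mult_0_right)
  qed
  then obtain B where "B ** (transpose X ** X) = mat 1"
    using matrix_left_invertible_ker by blast
  then show ?thesis
    by (metis matrix_inv_eqI matrix_left_right_inverse)
qed

lemma xi_eq_sqrt_gram_inverse:
  fixes X :: "real^'k^'n"
  assumes "rank X = CARD('k)"
  shows "xi X i = sqrt (real CARD('n) * matrix_inv (transpose X ** X) $ i $ i)"
proof -
  let ?G = "transpose X ** X"
  have "?G ** matrix_inv ?G = mat 1"
    using gram_matrix_inverse[OF assms] matrix_left_right_inverse by blast
  then have "matrix_inv ((1 / real CARD('n)) *\<^sub>R ?G) = real CARD('n) *\<^sub>R matrix_inv ?G"
    by (intro matrix_inv_eqI)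
      (simp add: matrix_scalar_ac scalar_matrix_assoc[symmetric])
  then show ?thesis
    by (simp add: xi_def)
qed

text \<open>The vector \<open>a\<close> is row \<open>i\<close> of \<open>L = (X'X)\<^sup>-\<^sup>1 X'\<close>. From \<open>L X = I\<close> follow unbiasedness and
  \<open>a \<noteq> 0\<close>, and \<open>L L' = (L X) ((X'X)\<^sup>-\<^sup>1)' = ((X'X)\<^sup>-\<^sup>1)'\<close> has the same diagonal as \<open>(X'X)\<^sup>-\<^sup>1\<close>.\<close>
lemma ls_estimator_component_error:
  fixes X :: "real^'k^'n"
  assumes X: "rank X = CARD('k)"
  obtains a where "a \<noteq> 0" "norm a = xi X i / sqrt (real CARD('n))"
    "\<And>\<theta> v. ls_estimator X (X *v \<theta> + v) $ i = \<theta> $ i + a \<bullet> v"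
proof -
  define G where "G = matrix_inv (transpose X ** X)"
  define L where "L = G ** transpose X"
  have LX: "L ** X = mat 1"
    using gram_matrix_inverse[OF X] by (simp add: L_def G_def matrix_mul_assoc)
  have LL: "L ** transpose L = transpose G"
  proof -
    have "L ** transpose L = (L ** X) ** transpose G"
      by (simp add: L_def matrix_transpose_mul transpose_transpose matrix_mul_assoc)
    then show ?thesis using LX by simp
  qed
  show thesis
  proof
    have "(\<Sum>j\<in>UNIV. L $ i $ j * X $ j $ i) = 1"
      using arg_cong[OF LX, of "\<lambda>A. A $ i $ i"] by (simp add: matrix_matrix_mult_def mat_def)
    then show "L $ i \<noteq> 0" by auto
    have "(norm (L $ i))\<^sup>2 = (L ** transpose L) $ i $ i"
      unfolding power2_norm_eq_inner
      by (simp add: inner_vec_def matrix_matrix_mult_def transpose_def)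
    then have "(norm (L $ i))\<^sup>2 = G $ i $ i"
      by (simp only: LL) (simp add: transpose_def)
    then have "norm (L $ i) = sqrt (G $ i $ i)"
      by (metis norm_ge_zero real_sqrt_unique)
    then show "norm (L $ i) = xi X i / sqrt (real CARD('n))"
      by (simp add: xi_eq_sqrt_gram_inverse[OF X] G_def real_sqrt_mult)
    show "ls_estimator X (X *v \<theta> + v) $ i = \<theta> $ i + L $ i \<bullet> v" for \<theta> v
    proof -
      have "ls_estimator X y = L *v y" for y
        by (simp only: ls_estimator_def L_def G_def matrix_vector_mul_assoc)
      then have "ls_estimator X (X *v \<theta> + v) = (L ** X) *v \<theta> + L *v v"
        by (simp add: matrix_vector_right_distrib matrix_vector_mul_assoc)
      then show ?thesis
        by (simp add: LX matrix_vector_mul_component)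
    qed
  qed
qed

section \<open>Soft thresholding of a normal variable\<close>

definition soft_threshold :: "real \<Rightarrow> real \<Rightarrow> real" where
  "soft_threshold e t = sgn t * max (\<bar>t\<bar> - e) 0"

lemma borel_measurable_soft_threshold [measurable]: "soft_threshold e \<in> borel_measurable borel"
  unfolding soft_threshold_def sgn_real_def by measurable

lemma soft_threshold_eq:
  "0 \<le> e \<Longrightarrow> soft_threshold e t = (if e < t then t - e else if t < - e then t + e else 0)"
  by (auto simp: soft_threshold_def sgn_real_def max_def)

lemma soft_threshold_mult:
  assumes "0 < s"
  shows "soft_threshold (s * e) (s * t) = s * soft_threshold e t"
proof -
  have "max (s * \<bar>t\<bar> - s * e) 0 = s * max (\<bar>t\<bar> - e) 0"
    using assms by (simp add: max_def right_diff_distrib)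
  then show ?thesis
    using assms by (simp add: soft_threshold_def sgn_mult abs_mult)
qed

text \<open>The sets \<open>{t. soft_threshold e t \<le> y}\<close> are half-lines, since soft thresholding is monotone and
  continuous. At \<open>y = 0\<close> the whole flat piece \<open>{-e..e}\<close> is included, hence the jump of the endpoint
  from \<open>y - e\<close> to \<open>y + e\<close> there.\<close>
lemma soft_threshold_le_iff:
  "0 \<le> e \<Longrightarrow> soft_threshold e t \<le> y \<longleftrightarrow> t \<le> (if 0 \<le> y then y + e else y - e)"
  by (auto simp: soft_threshold_eq)

lemma cdf_soft_threshold_std_normal:
  assumes c: "0 < c" and e: "0 \<le> e"
  shows "cdf (distr std_normal_distribution borel (\<lambda>z. c * (soft_threshold e (z + \<mu>) - \<mu>))) x =
      std_normal_cdf (x / c + e) * of_bool (0 \<le> x / c + \<mu>)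
    + std_normal_cdf (x / c - e) * of_bool (x / c + \<mu> < 0)"
proof -
  let ?y = "x / c + \<mu>"
  have "c * (soft_threshold e (z + \<mu>) - \<mu>) \<le> x \<longleftrightarrow> z \<le> (if 0 \<le> ?y then x / c + e else x / c - e)" for z
  proof -
    have "c * (soft_threshold e (z + \<mu>) - \<mu>) \<le> x \<longleftrightarrow> soft_threshold e (z + \<mu>) \<le> ?y"
      using c by (simp add: field_simps)
    then show ?thesis
      by (simp add: soft_threshold_le_iff[OF e] algebra_simps)
  qed
  then have "(\<lambda>z. c * (soft_threshold e (z + \<mu>) - \<mu>)) -` {..x} = {..if 0 \<le> ?y then x / c + e else x / c - e}"
    by auto
  then show ?thesis
    by (simp add: cdf_def measure_distr std_normal_cdf_def)
qed

text \<open>With \<open>t = z + \<mu>\<close>, the transformation is constantly \<open>- c * \<mu>\<close> for \<open>\<bar>t\<bar> \<le> e\<close>, which yields the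
  atom, and it is \<open>z \<mapsto> c * (z - e)\<close> for \<open>t > e\<close> and \<open>z \<mapsto> c * (z + e)\<close> for \<open>t < - e\<close>, where the
  substitutions \<open>z = x / c + e\<close> and \<open>z = x / c - e\<close> yield the two density terms.\<close>
lemma emeasure_soft_threshold_std_normal:
  assumes c: "0 < c" and e: "0 \<le> e" and A [measurable]: "A \<in> sets borel"
  shows "emeasure (distr std_normal_distribution borel (\<lambda>z. c * (soft_threshold e (z + \<mu>) - \<mu>))) A =
      ennreal (std_normal_cdf (- \<mu> + e) - std_normal_cdf (- \<mu> - e)) * emeasure (return borel (- c * \<mu>)) A
    + emeasure (density lborel (\<lambda>x. ennreal (1 / c *
        (std_normal_density (x / c + e) * of_bool (0 < x / c + \<mu>)
       + std_normal_density (x / c - e) * of_bool (x / c + \<mu> < 0))))) A"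
proof -
  interpret N: real_distribution std_normal_distribution
    by (rule real_dist_normal_dist)
  let ?g = "\<lambda>z. c * (soft_threshold e (z + \<mu>) - \<mu>)"
  let ?\<phi> = "\<lambda>z. ennreal (std_normal_density z)"
  \<comment> \<open>Half-open, so that its probability is a difference of values of the distribution function; the point that is lost is a null set.\<close>
  let ?I = "{- \<mu> - e <.. - \<mu> + e}"
  let ?up = "\<lambda>z. ?\<phi> z * (of_bool (0 < z - e + \<mu>) * indicator A (c * (z - e)))"
  let ?lo = "\<lambda>z. ?\<phi> z * (of_bool (z + e + \<mu> < 0) * indicator A (c * (z + e)))"
  have "emeasure (distr std_normal_distribution borel ?g) A
      = (\<integral>\<^sup>+z. ?\<phi> z * indicator A (?g z) \<partial>lborel)"
  proof -
    have "emeasure (distr std_normal_distribution borel ?g) A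
        = (\<integral>\<^sup>+x. indicator A x \<partial>distr std_normal_distribution borel ?g)"
      by simp
    also have "\<dots> = (\<integral>\<^sup>+z. ?\<phi> z * indicator A (?g z) \<partial>lborel)"
      by (subst nn_integral_distr) (simp_all add: nn_integral_density)
    finally show ?thesis .
  qed
  also have "\<dots> = (\<integral>\<^sup>+z. ?\<phi> z * indicator ?I z * indicator A (- c * \<mu>) + (?up z + ?lo z) \<partial>lborel)"
  proof (rule nn_integral_cong_AE, use AE_lborel_singleton[of "- \<mu> - e"] in eventually_elim)
    fix z assume "z \<noteq> - \<mu> - e"
    then consider "e < z + \<mu>" | "z \<in> ?I" | "z + \<mu> < - e" by fastforce
    then show "?\<phi> z * indicator A (?g z) =
        ?\<phi> z * indicator ?I z * indicator A (- c * \<mu>) + (?up z + ?lo z)"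
      using e by cases (auto simp: soft_threshold_eq algebra_simps)
  qed
  also have "\<dots> = (\<integral>\<^sup>+z. ?\<phi> z * indicator ?I z * indicator A (- c * \<mu>) \<partial>lborel)
      + ((\<integral>\<^sup>+z. ?up z \<partial>lborel) + (\<integral>\<^sup>+z. ?lo z \<partial>lborel))"
    by (simp add: nn_integral_add)
  also have "(\<integral>\<^sup>+z. ?\<phi> z * indicator ?I z * indicator A (- c * \<mu>) \<partial>lborel) =
      ennreal (std_normal_cdf (- \<mu> + e) - std_normal_cdf (- \<mu> - e)) * emeasure (return borel (- c * \<mu>)) A"
  proof -
    have "(\<integral>\<^sup>+z. ?\<phi> z * indicator ?I z * indicator A (- c * \<mu>) \<partial>lborel)
        = emeasure std_normal_distribution ?I * indicator A (- c * \<mu>)"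
      by (subst nn_integral_multc) (simp_all add: emeasure_density)
    also have "emeasure std_normal_distribution ?I =
        ennreal (std_normal_cdf (- \<mu> + e) - std_normal_cdf (- \<mu> - e))"
      unfolding std_normal_cdf_def using e by (subst N.emeasure_Ioc) simp_all
    finally show ?thesis by simp
  qed
  also have "(\<integral>\<^sup>+z. ?up z \<partial>lborel) =
      (\<integral>\<^sup>+x. ennreal (1 / c * (std_normal_density (x / c + e) * of_bool (0 < x / c + \<mu>))) * indicator A x \<partial>lborel)"
    using c
    by (subst nn_integral_real_affine[where c="1 / c" and t=e])
      (auto simp flip: nn_integral_cmult simp: ennreal_mult'[symmetric] add.commute
        intro!: nn_integral_cong split: split_indicator)
  also have "(\<integral>\<^sup>+z. ?lo z \<partial>lborel) =
      (\<integral>\<^sup>+x. ennreal (1 / c * (std_normal_density (x / c - e) * of_bool (x / c + \<mu> < 0))) * indicator A x \<partial>lborel)"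
    using c
    by (subst nn_integral_real_affine[where c="1 / c" and t="- e"])
      (auto simp flip: nn_integral_cmult simp: ennreal_mult'[symmetric] add.commute
        intro!: nn_integral_cong split: split_indicator)
  finally show ?thesis
    using c
    by (simp add: emeasure_density nn_integral_add[symmetric] distrib_left ennreal_plus distrib_right
        del: ennreal_plus_if cong: nn_integral_cong)
qed

section \<open>The law of the soft-thresholding estimator\<close>

theorem proposition20:
  fixes M :: "'a measure" and X :: "real^'k^'n" and \<theta> :: "real^'k" and \<sigma> :: real
    and u Y :: "'a \<Rightarrow> real^'n" and i :: 'k and \<alpha> \<eta> :: real
  defines "n \<equiv> real CARD('n)"
    and "\<xi> \<equiv> xi X i"
    and "H \<equiv> distr M borel
           (\<lambda>\<omega>. inverse \<sigma> * \<alpha> * (soft_threshold_estimator X \<sigma> \<eta> (Y \<omega>) i - \<theta> $ i))"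
  assumes "prob_space M"
    and "rank X = CARD('k)"
    and "0 < \<sigma>"
    and "distributed M lborel u (mv_normal_density 0 (\<sigma>\<^sup>2 *\<^sub>R mat 1))"
    and "\<And>\<omega>. \<omega> \<in> space M \<Longrightarrow> Y \<omega> = X *v \<theta> + u \<omega>"
    and "0 < \<eta>" and "0 < \<alpha>"
  shows "(\<forall>x. cdf H x =
            std_normal_cdf (sqrt n * x / (\<alpha> * \<xi>) + sqrt n * \<eta>)
              * of_bool (inverse \<alpha> * x + \<theta> $ i / \<sigma> \<ge> 0)
          + std_normal_cdf (sqrt n * x / (\<alpha> * \<xi>) - sqrt n * \<eta>)
              * of_bool (inverse \<alpha> * x + \<theta> $ i / \<sigma> < 0))
       \<and> (\<forall>A \<in> sets borel. emeasure H A =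
            ennreal (std_normal_cdf (sqrt n * (- \<theta> $ i / (\<sigma> * \<xi>) + \<eta>))
                   - std_normal_cdf (sqrt n * (- \<theta> $ i / (\<sigma> * \<xi>) - \<eta>)))
              * emeasure (return borel (- \<alpha> * \<theta> $ i / \<sigma>)) A
          + emeasure (density lborel (\<lambda>x. ennreal (sqrt n / (\<alpha> * \<xi>) *
              (std_normal_density (sqrt n * x / (\<alpha> * \<xi>) + sqrt n * \<eta>)
                 * of_bool (inverse \<alpha> * x + \<theta> $ i / \<sigma> > 0)
             + std_normal_density (sqrt n * x / (\<alpha> * \<xi>) - sqrt n * \<eta>)
                 * of_bool (inverse \<alpha> * x + \<theta> $ i / \<sigma> < 0))))) A)"
proof -
  interpret prob_space M by fact
  have n: "0 < sqrt n" by (simp add: n_def)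
  obtain a where a: "a \<noteq> 0" "norm a = \<xi> / sqrt n"
    and ls: "\<And>\<theta> v. ls_estimator X (X *v \<theta> + v) $ i = \<theta> $ i + a \<bullet> v"
    using ls_estimator_component_error[OF \<open>rank X = CARD('k)\<close>, of i] unfolding n_def \<xi>_def by metis
  have \<xi>: "0 < \<xi>"
    using a n by (metis zero_less_norm_iff zero_less_divide_iff order_less_asym)
  \<comment> \<open>Standardisation: the error of the estimator has standard deviation \<open>s\<close>; \<open>\<mu>\<close> and \<open>e\<close> are the parameter and the threshold in units of \<open>s\<close>.\<close>
  define s where "s = \<sigma> * norm a"
  define c where "c = \<alpha> * \<xi> / sqrt n"
  define \<mu> where "\<mu> = \<theta> $ i / s"
  define e where "e = sqrt n * \<eta>"
  \<comment> \<open>The subtracted 0 is the mean, written out in the form in which normal variables are standardised.\<close>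
  define Z where "Z = (\<lambda>\<omega>. (a \<bullet> u \<omega> - 0) / s)"
  define g where "g = (\<lambda>z. c * (soft_threshold e (z + \<mu>) - \<mu>))"
  have s: "0 < s" "s = \<sigma> * \<xi> / sqrt n"
    using \<open>0 < \<sigma>\<close> \<xi> n a(2) by (simp_all add: s_def)
  have c: "0 < c"
    using \<open>0 < \<alpha>\<close> \<xi> n by (simp add: c_def)
  have e: "0 \<le> e"
    using \<open>0 < \<eta>\<close> n by (simp add: e_def)

  have "distributed M lborel u (\<lambda>z. ennreal (\<Prod>b\<in>Basis. normal_density 0 \<sigma> (z \<bullet> b)))"
    using \<open>distributed M lborel u _\<close> by (simp add: mv_normal_density_isotropic[OF \<open>0 < \<sigma>\<close>])
  then have "distributed M lborel (\<lambda>\<omega>. a \<bullet> u \<omega>) (normal_density 0 s)"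
    unfolding s_def using \<open>0 < \<sigma>\<close> a(1) by (rule distributed_inner_isotropic_normal)
  then have Z: "distributed M lborel Z std_normal_density"
    unfolding Z_def normal_standard_normal_convert[OF s(1)] .
  have Zm [measurable]: "Z \<in> borel_measurable M"
    using distributed_measurable[OF Z] by simp
  have gm [measurable]: "g \<in> borel_measurable borel"
    unfolding g_def by measurable
  have Z_law: "distr M borel Z = std_normal_distribution"
    using distributed_distr_eq_density[OF Z] by (metis distr_cong sets_lborel)

  have "inverse \<sigma> * \<alpha> * (soft_threshold_estimator X \<sigma> \<eta> (Y \<omega>) i - \<theta> $ i) = g (Z \<omega>)"
    if \<omega>: "\<omega> \<in> space M" for \<omega>
  proof -
    have "soft_threshold_estimator X \<sigma> \<eta> (Y \<omega>) i = soft_threshold (\<sigma> * \<xi> * \<eta>) (\<theta> $ i + a \<bullet> u \<omega>)"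
      using \<open>\<And>\<omega>. \<omega> \<in> space M \<Longrightarrow> Y \<omega> = X *v \<theta> + u \<omega>\<close>[OF \<omega>] by (simp add: soft_threshold_estimator_def soft_threshold_def ls \<xi>_def)
    also have "\<sigma> * \<xi> * \<eta> = s * e"
      using n by (simp add: s(2) e_def)
    also have "\<theta> $ i + a \<bullet> u \<omega> = s * (Z \<omega> + \<mu>)"
      using s(1) by (simp add: Z_def \<mu>_def field_simps)
    also have "soft_threshold (s * e) (s * (Z \<omega> + \<mu>)) = s * soft_threshold e (Z \<omega> + \<mu>)"
      by (rule soft_threshold_mult[OF s(1)])
    finally have soft: "soft_threshold_estimator X \<sigma> \<eta> (Y \<omega>) i = s * soft_threshold e (Z \<omega> + \<mu>)" .
    have "\<theta> $ i = s * \<mu>"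
      using s(1) by (simp add: \<mu>_def)
    then have "inverse \<sigma> * \<alpha> * (soft_threshold_estimator X \<sigma> \<eta> (Y \<omega>) i - \<theta> $ i) =
        inverse \<sigma> * \<alpha> * s * (soft_threshold e (Z \<omega> + \<mu>) - \<mu>)"
      by (simp add: soft algebra_simps)
    moreover have "inverse \<sigma> * \<alpha> * s = c"
      using \<open>0 < \<sigma>\<close> by (simp add: s(2) c_def)
    ultimately show ?thesis by (simp add: g_def)
  qed
  then have "H = distr M borel (\<lambda>\<omega>. g (Z \<omega>))"
    unfolding H_def by (intro distr_cong) simp_all
  also have "\<dots> = distr (distr M borel Z) borel g"
    by (subst distr_distr) (simp_all add: comp_def)
  finally have H: "H = distr std_normal_distribution borel (\<lambda>z. c * (soft_threshold e (z + \<mu>) - \<mu>))"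
    by (simp add: Z_law g_def)

  have scale: "x / c = sqrt n * x / (\<alpha> * \<xi>)" for x
    by (simp add: c_def)
  \<comment> \<open>The sign conditions on both sides agree because their arguments differ by a positive factor.\<close>
  have factor: "x / c + \<mu> = sqrt n / \<xi> * (inverse \<alpha> * x + \<theta> $ i / \<sigma>)" for x
    using \<xi> n \<open>0 < \<alpha>\<close> \<open>0 < \<sigma>\<close> by (simp add: c_def \<mu>_def s(2) field_simps)
  have sign: "0 \<le> x / c + \<mu> \<longleftrightarrow> inverse \<alpha> * x + \<theta> $ i / \<sigma> \<ge> 0"
    "0 < x / c + \<mu> \<longleftrightarrow> inverse \<alpha> * x + \<theta> $ i / \<sigma> > 0"
    "x / c + \<mu> < 0 \<longleftrightarrow> inverse \<alpha> * x + \<theta> $ i / \<sigma> < 0" for x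
  proof -
    have "0 < sqrt n / \<xi>" using n \<xi> by simp
    then show "0 \<le> x / c + \<mu> \<longleftrightarrow> inverse \<alpha> * x + \<theta> $ i / \<sigma> \<ge> 0"
      "0 < x / c + \<mu> \<longleftrightarrow> inverse \<alpha> * x + \<theta> $ i / \<sigma> > 0"
      "x / c + \<mu> < 0 \<longleftrightarrow> inverse \<alpha> * x + \<theta> $ i / \<sigma> < 0"
      unfolding factor by (simp_all only: zero_le_mult_iff zero_less_mult_iff mult_less_0_iff) auto
  qed
  have atom: "- \<mu> + e = sqrt n * (- \<theta> $ i / (\<sigma> * \<xi>) + \<eta>)"
    "- \<mu> - e = sqrt n * (- \<theta> $ i / (\<sigma> * \<xi>) - \<eta>)"
    "- c * \<mu> = - \<alpha> * \<theta> $ i / \<sigma>"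
    using \<xi> n by (simp_all add: \<mu>_def s(2) e_def c_def algebra_simps)

  show ?thesis
  proof (intro conjI allI ballI)
    show "cdf H x =
            std_normal_cdf (sqrt n * x / (\<alpha> * \<xi>) + sqrt n * \<eta>)
              * of_bool (inverse \<alpha> * x + \<theta> $ i / \<sigma> \<ge> 0)
          + std_normal_cdf (sqrt n * x / (\<alpha> * \<xi>) - sqrt n * \<eta>)
              * of_bool (inverse \<alpha> * x + \<theta> $ i / \<sigma> < 0)" for x
      using cdf_soft_threshold_std_normal[OF c e, of \<mu> x]
      unfolding H sign unfolding scale e_def .
    show "emeasure H A =
            ennreal (std_normal_cdf (sqrt n * (- \<theta> $ i / (\<sigma> * \<xi>) + \<eta>))
                   - std_normal_cdf (sqrt n * (- \<theta> $ i / (\<sigma> * \<xi>) - \<eta>)))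
              * emeasure (return borel (- \<alpha> * \<theta> $ i / \<sigma>)) A
          + emeasure (density lborel (\<lambda>x. ennreal (sqrt n / (\<alpha> * \<xi>) *
              (std_normal_density (sqrt n * x / (\<alpha> * \<xi>) + sqrt n * \<eta>)
                 * of_bool (inverse \<alpha> * x + \<theta> $ i / \<sigma> > 0)
             + std_normal_density (sqrt n * x / (\<alpha> * \<xi>) - sqrt n * \<eta>)
                 * of_bool (inverse \<alpha> * x + \<theta> $ i / \<sigma> < 0))))) A"
      if "A \<in> sets borel" for A
      using emeasure_soft_threshold_std_normal[OF c e that, of \<mu>]
      unfolding H sign atom unfolding scale e_def mult_1_right .
  qed
qed

end
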